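(* Let $R$ be a principal ideal domain with field of fractions $F$, let $V$ be a $2m$-dimensional $F$-vector space with a non-degenerate alternating bilinear form $\langle\,,\rangle$, let $N\in R$ be square free, and let $\Lambda\subseteq V$ be an $R$-lattice with $\langle\Lambda,\Lambda\rangle\subseteq R$ and of level dividing $N$. Let $Z$ be a primitive totally isotropic submodule of $\Lambda$ of rank $r\le m$. Then there are a basis $(e_1,\dots,e_r)$ of $Z$ and vectors $f_1,\dots,f_r\in\Lambda$ generating a totally isotropic submodule of $\Lambda$ and satisfying $\langle e_i,f_j\rangle=d_i\delta_{ij}$ with $d_i\mid N$, such that $M=M(Z):=\bigoplus_{i=1}^rRe_i\oplus\bigoplus_{i=1}^rRf_i$ splits off orthogonally, i.e. $\Lambda=M\perp\Lambda'$ for a submodule $\Lambda'$. Moreover, if $X\supseteq Z$ is a submodule of $\Lambda$ with $Z\subseteq\operatorname{rad}(X)$, then $X=Z\perp(X\cap\Lambda')$, and $X':=X\cap\Lambda'$ is non-degenerate if and only if $Z=\operatorname{rad}(X)$. In particular, if $X=Z$ is maximal totally isotropic, there exist a basis $(e_1,\dots,e_m)$ of $X$ and vectors $f_1,\dots,f_m\in\Lambda$ generating a totally isotropic submodule and satisfying $\langle e_i,f_j\rangle=d_i\delta_{ij}$ with $d_i\mid N$ such that $\Lambda=\bigoplus_{i=1}^mRe_i\oplus\bigoplus_{i=1}^mRf_i$.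
   Context: An $R$-lattice on $V$ is a free $R$-submodule of rank $2m$ spanning $V$. The dual is $\Lambda^\#=\{v\in V:\langle v,\Lambda\rangle\subseteq R\}$; $\Lambda$ has level dividing $N$ iff $\Lambda\supseteq N\Lambda^\#$. A submodule $Z\subseteq\Lambda$ is primitive if $Z=FZ\cap\Lambda$, totally isotropic if $\langle Z,Z\rangle=0$. For a submodule $X$, $\operatorname{rad}(X)=\{x\in X:\langle x,X\rangle=0\}$, and $X$ is non-degenerate if $\operatorname{rad}(X)=0$. *)

theory Defs
  imports
    Complex_Main
    "HOL-Computational_Algebra.Squarefree"
    "HOL-Computational_Algebra.Fraction_Field"
begin

class principal_ideal_domain = idom +
  assumes ideal_principal:
    "\<lbrakk>0 \<in> I; \<And>x y. x \<in> I \<Longrightarrow> y \<in> I \<Longrightarrow> x + y \<in> I; \<And>a x. x \<in> I \<Longrightarrow> a * x \<in> I\<rbrakk>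
      \<Longrightarrow> \<exists>g. I = {a * g | a. True}"

text \<open>
  The field of fractions is characterised by an embedding \<open>\<iota>\<close> of the domain, so that the field
  is not tied to the particular construction \<^typ>\<open>'r fract\<close>.
\<close>
locale fraction_field =
  fixes \<iota> :: "'r::idom \<Rightarrow> 'f::field"
  assumes embed_add: "\<iota> (a + b) = \<iota> a + \<iota> b"
    and embed_mult: "\<iota> (a * b) = \<iota> a * \<iota> b"
    and embed_one: "\<iota> 1 = 1"
    and embed_inj: "inj \<iota>"
    and embed_quotient: "\<exists>a b. b \<noteq> 0 \<and> x = \<iota> a / \<iota> b"

lemma fraction_field_Fract: "fraction_field (\<lambda>a::'r::idom. Fract a 1)"
proof
  fix x :: "'r fract"
  show "\<exists>a b. b \<noteq> 0 \<and> x = Fract a 1 / Fract b 1"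
    by (cases x) auto
qed (auto simp: inj_def eq_fract One_fract_def)

locale alternating_space = vector_space scale
  for scale :: "'f::field \<Rightarrow> 'v::ab_group_add \<Rightarrow> 'v" +
  fixes form :: "'v \<Rightarrow> 'v \<Rightarrow> 'f"
  assumes linear_left: "Vector_Spaces.linear scale (*) (\<lambda>u. form u v)"
    and linear_right: "Vector_Spaces.linear scale (*) (\<lambda>v. form u v)"
    and alternating: "form v v = 0"
    and nondegenerate_form: "(\<And>w. form v w = 0) \<Longrightarrow> v = 0"

text \<open>
  Throughout, \<open>\<iota> :: 'r \<Rightarrow> 'f\<close> embeds the base ring \<open>R\<close> into its field of fractions \<open>F\<close> and
  \<open>scale\<close> is the action of \<open>F\<close> on the vector space \<open>V\<close>, whose carrier is the whole type \<open>'v\<close>.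
  The subring \<open>R\<close> of \<open>F\<close> is \<^term>\<open>range \<iota>\<close>. The \<open>R\<close>-module structure of \<open>V\<close> is obtained by
  restriction of scalars.
\<close>
abbreviation (input) restrict_scale :: "('r \<Rightarrow> 'f) \<Rightarrow> ('f \<Rightarrow> 'v \<Rightarrow> 'v) \<Rightarrow> 'r \<Rightarrow> 'v \<Rightarrow> 'v" where
  "restrict_scale \<iota> scale \<equiv> (\<lambda>a. scale (\<iota> a))"

abbreviation R_submodule ::
    "('r::comm_ring_1 \<Rightarrow> 'f) \<Rightarrow> ('f \<Rightarrow> 'v::ab_group_add \<Rightarrow> 'v) \<Rightarrow> 'v set \<Rightarrow> bool" where
  "R_submodule \<iota> scale \<equiv> module.subspace (restrict_scale \<iota> scale)"

abbreviation R_span ::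
    "('r::comm_ring_1 \<Rightarrow> 'f) \<Rightarrow> ('f \<Rightarrow> 'v::ab_group_add \<Rightarrow> 'v) \<Rightarrow> 'v set \<Rightarrow> 'v set" where
  "R_span \<iota> scale \<equiv> module.span (restrict_scale \<iota> scale)"

abbreviation R_independent ::
    "('r::comm_ring_1 \<Rightarrow> 'f) \<Rightarrow> ('f \<Rightarrow> 'v::ab_group_add \<Rightarrow> 'v) \<Rightarrow> 'v set \<Rightarrow> bool" where
  "R_independent \<iota> scale S \<equiv> \<not> module.dependent (restrict_scale \<iota> scale) S"

abbreviation F_span :: "('f::field \<Rightarrow> 'v::ab_group_add \<Rightarrow> 'v) \<Rightarrow> 'v set \<Rightarrow> 'v set" where
  "F_span scale \<equiv> module.span scale"

text \<open>
  The rank of an \<open>R\<close>-submodule \<open>Z\<close> of \<open>V\<close> is the dimension of \<open>FZ\<close>; it does not presuppose that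
  \<open>Z\<close> is free.
\<close>
definition R_rank :: "('f::field \<Rightarrow> 'v::ab_group_add \<Rightarrow> 'v) \<Rightarrow> 'v set \<Rightarrow> nat" where
  "R_rank scale Z = vector_space.dim scale (F_span scale Z)"

definition R_basis_on ::
    "('r::comm_ring_1 \<Rightarrow> 'f) \<Rightarrow> ('f \<Rightarrow> 'v::ab_group_add \<Rightarrow> 'v) \<Rightarrow>
      'i set \<Rightarrow> ('i \<Rightarrow> 'v) \<Rightarrow> 'v set \<Rightarrow> bool" where
  "R_basis_on \<iota> scale I e X \<longleftrightarrow>
    inj_on e I \<and> R_independent \<iota> scale (e ` I) \<and> R_span \<iota> scale (e ` I) = X"

definition R_lattice ::
    "('r::comm_ring_1 \<Rightarrow> 'f::field) \<Rightarrow> ('f \<Rightarrow> 'v::ab_group_add \<Rightarrow> 'v) \<Rightarrow> nat \<Rightarrow> 'v set \<Rightarrow> bool" where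
  "R_lattice \<iota> scale m \<Lambda> \<longleftrightarrow>
    (\<exists>b. R_basis_on \<iota> scale {1..2 * m} b \<Lambda>) \<and> F_span scale \<Lambda> = UNIV"

definition integral_on :: "('r \<Rightarrow> 'f) \<Rightarrow> ('v \<Rightarrow> 'v \<Rightarrow> 'f) \<Rightarrow> 'v set \<Rightarrow> bool" where
  "integral_on \<iota> form \<Lambda> \<longleftrightarrow> (\<forall>x\<in>\<Lambda>. \<forall>y\<in>\<Lambda>. form x y \<in> range \<iota>)"

definition dual_lattice :: "('r \<Rightarrow> 'f) \<Rightarrow> ('v \<Rightarrow> 'v \<Rightarrow> 'f) \<Rightarrow> 'v set \<Rightarrow> 'v set" where
  "dual_lattice \<iota> form \<Lambda> = {v. \<forall>x\<in>\<Lambda>. form v x \<in> range \<iota>}"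

definition level_dvd ::
    "('r \<Rightarrow> 'f) \<Rightarrow> ('f \<Rightarrow> 'v \<Rightarrow> 'v) \<Rightarrow> ('v \<Rightarrow> 'v \<Rightarrow> 'f) \<Rightarrow> 'v set \<Rightarrow> 'r \<Rightarrow> bool" where
  "level_dvd \<iota> scale form \<Lambda> N \<longleftrightarrow> scale (\<iota> N) ` dual_lattice \<iota> form \<Lambda> \<subseteq> \<Lambda>"

definition primitive_in ::
    "('f::field \<Rightarrow> 'v::ab_group_add \<Rightarrow> 'v) \<Rightarrow> 'v set \<Rightarrow> 'v set \<Rightarrow> bool" where
  "primitive_in scale \<Lambda> Z \<longleftrightarrow> Z = F_span scale Z \<inter> \<Lambda>"

definition totally_isotropic :: "('v \<Rightarrow> 'v \<Rightarrow> 'f::zero) \<Rightarrow> 'v set \<Rightarrow> bool" where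
  "totally_isotropic form X \<longleftrightarrow> (\<forall>x\<in>X. \<forall>y\<in>X. form x y = 0)"

definition maximal_totally_isotropic ::
    "('r::comm_ring_1 \<Rightarrow> 'f::field) \<Rightarrow> ('f \<Rightarrow> 'v::ab_group_add \<Rightarrow> 'v) \<Rightarrow>
      ('v \<Rightarrow> 'v \<Rightarrow> 'f) \<Rightarrow> 'v set \<Rightarrow> 'v set \<Rightarrow> bool" where
  "maximal_totally_isotropic \<iota> scale form \<Lambda> X \<longleftrightarrow>
    R_submodule \<iota> scale X \<and> X \<subseteq> \<Lambda> \<and> totally_isotropic form X \<and>
    (\<forall>Y. R_submodule \<iota> scale Y \<and> Y \<subseteq> \<Lambda> \<and> totally_isotropic form Y \<and> X \<subseteq> Y \<longrightarrow> Y = X)"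

definition radical :: "('v \<Rightarrow> 'v \<Rightarrow> 'f::zero) \<Rightarrow> 'v set \<Rightarrow> 'v set" where
  "radical form X = {x\<in>X. \<forall>y\<in>X. form x y = 0}"

definition nondegenerate_on :: "('v::zero \<Rightarrow> 'v \<Rightarrow> 'f::zero) \<Rightarrow> 'v set \<Rightarrow> bool" where
  "nondegenerate_on form X \<longleftrightarrow> radical form X = {0}"

text \<open>\<open>M\<close> is the internal direct sum of the submodules \<open>A i\<close>, for \<open>i\<close> in the finite set \<open>I\<close>.\<close>
definition internal_direct_sum :: "'i set \<Rightarrow> ('i \<Rightarrow> 'v::ab_group_add set) \<Rightarrow> 'v set \<Rightarrow> bool" where
  "internal_direct_sum I A M \<longleftrightarrow>
    M = {(\<Sum>i\<in>I. x i) | x. \<forall>i\<in>I. x i \<in> A i} \<and>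
    (\<forall>x. (\<forall>i\<in>I. x i \<in> A i) \<and> (\<Sum>i\<in>I. x i) = 0 \<longrightarrow> (\<forall>i\<in>I. x i = 0))"

text \<open>\<open>L = A \<perp> B\<close>\<close>
definition orthogonal_sum ::
    "('v::ab_group_add \<Rightarrow> 'v \<Rightarrow> 'f::zero) \<Rightarrow> 'v set \<Rightarrow> 'v set \<Rightarrow> 'v set \<Rightarrow> bool" where
  "orthogonal_sum form L A B \<longleftrightarrow>
    L = {a + b | a b. a \<in> A \<and> b \<in> B} \<and> A \<inter> B = {0} \<and> (\<forall>a\<in>A. \<forall>b\<in>B. form a b = 0)"

text \<open>
  \<open>M = \<Oplus>\<^sub>i R e\<^sub>i \<oplus> \<Oplus>\<^sub>i R f\<^sub>i\<close> with \<open>1 \<le> i \<le> r\<close>, indexed by the disjoint sum of two copies of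
  \<open>{1..r}\<close>.
\<close>
definition pair_sum ::
    "('r::comm_ring_1 \<Rightarrow> 'f) \<Rightarrow> ('f \<Rightarrow> 'v::ab_group_add \<Rightarrow> 'v) \<Rightarrow> nat \<Rightarrow>
      (nat \<Rightarrow> 'v) \<Rightarrow> (nat \<Rightarrow> 'v) \<Rightarrow> 'v set \<Rightarrow> bool" where
  "pair_sum \<iota> scale r e f M \<longleftrightarrow>
    internal_direct_sum ({1..r} <+> {1..r}) (\<lambda>k. R_span \<iota> scale {case_sum e f k}) M"

definition adapted_system ::
    "('r::comm_ring_1 \<Rightarrow> 'f::field) \<Rightarrow> ('f \<Rightarrow> 'v::ab_group_add \<Rightarrow> 'v) \<Rightarrow> ('v \<Rightarrow> 'v \<Rightarrow> 'f) \<Rightarrow>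
      'r \<Rightarrow> 'v set \<Rightarrow> 'v set \<Rightarrow> nat \<Rightarrow> (nat \<Rightarrow> 'v) \<Rightarrow> (nat \<Rightarrow> 'v) \<Rightarrow> (nat \<Rightarrow> 'r) \<Rightarrow> bool" where
  "adapted_system \<iota> scale form N \<Lambda> Z r e f d \<longleftrightarrow>
    R_basis_on \<iota> scale {1..r} e Z \<and>
    f ` {1..r} \<subseteq> \<Lambda> \<and>
    totally_isotropic form (R_span \<iota> scale (f ` {1..r})) \<and>
    (\<forall>i\<in>{1..r}. \<forall>j\<in>{1..r}. form (e i) (f j) = (if i = j then \<iota> (d i) else 0)) \<and>
    (\<forall>i\<in>{1..r}. d i dvd N)"

definition adapted_splitting ::
    "('r::comm_ring_1 \<Rightarrow> 'f::field) \<Rightarrow> ('f \<Rightarrow> 'v::ab_group_add \<Rightarrow> 'v) \<Rightarrow> ('v \<Rightarrow> 'v \<Rightarrow> 'f) \<Rightarrow>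
      'r \<Rightarrow> 'v set \<Rightarrow> 'v set \<Rightarrow> nat \<Rightarrow> (nat \<Rightarrow> 'v) \<Rightarrow> (nat \<Rightarrow> 'v) \<Rightarrow> (nat \<Rightarrow> 'r) \<Rightarrow>
      'v set \<Rightarrow> 'v set \<Rightarrow> bool" where
  "adapted_splitting \<iota> scale form N \<Lambda> Z r e f d M \<Lambda>' \<longleftrightarrow>
    adapted_system \<iota> scale form N \<Lambda> Z r e f d \<and>
    pair_sum \<iota> scale r e f M \<and>
    R_submodule \<iota> scale \<Lambda>' \<and>
    orthogonal_sum form \<Lambda> M \<Lambda>'"

end

theory Submission
  imports Defs
begin

text \<open>
  Let \<open>e \<in> \<Lambda>\<close> be primitive, so that \<open>\<langle>e, w\<rangle> = 1\<close> for some \<open>w \<in> \<Lambda>\<^sup>#\<close>, and let \<open>\<langle>e, \<Lambda>\<rangle> = d R\<close>,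
  with \<open>\<langle>e, y\<rangle> = d\<close> for some \<open>y \<in> \<Lambda>\<close>. From \<open>e / d \<in> \<Lambda>\<^sup>#\<close> and the level condition, \<open>d\<close> divides
  \<open>N\<close>, say \<open>N = d d'\<close>. As \<open>N\<close> is square free, \<open>a d + b d' = 1\<close> is solvable, and
  \<open>f = b N w + a d y\<close> lies in \<open>\<Lambda> \<inter> d \<Lambda>\<^sup>#\<close> and satisfies \<open>\<langle>e, f\<rangle> = d\<close>. Both \<open>\<langle>e, \<Lambda>\<rangle>\<close> and
  \<open>\<langle>f, \<Lambda>\<rangle>\<close> being contained in \<open>d R\<close>, the orthogonal projection onto the span of \<open>e\<close> and \<open>f\<close> maps
  \<open>\<Lambda>\<close> into \<open>R e + R f\<close>. The pairs are chosen one after the other in a fixed \<open>\<Lambda>\<close>: the next \<open>e\<close> is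
  taken in \<open>Z\<close> orthogonal to the previous pairs, and the next \<open>f\<close> is projected to their orthogonal
  complement.
\<close>

section \<open>Bezout relations in the base ring\<close>

text \<open>The ideal generated by \<open>c\<close> and \<open>d\<close> is principal, and the
  square of its generator divides \<open>c * d\<close>; squarefreeness makes the generator a
  unit.\<close>

lemma squarefree_mult_bezout:
  fixes c d :: "'a::principal_ideal_domain"
  assumes "squarefree (c * d)"
  shows "\<exists>a b. a * c + b * d = 1"
proof -
  let ?I = "{a * c + b * d | a b. True}"
  have "\<exists>g. ?I = {a * g | a. True}"
  proof (rule ideal_principal)
    show "0 \<in> ?I" by (auto intro!: exI[of _ 0])
    show "x + y \<in> ?I" if xy: "x \<in> ?I" "y \<in> ?I" for x y
    proof -
      from xy obtain a b a' b' where "x = a * c + b * d" "y = a' * c + b' * d" by blast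
      then have "x + y = (a + a') * c + (b + b') * d" by (simp add: algebra_simps)
      then show ?thesis by blast
    qed
    show "t * x \<in> ?I" if x: "x \<in> ?I" for t x
    proof -
      from x obtain a b where "x = a * c + b * d" by blast
      then have "t * x = (t * a) * c + (t * b) * d" by (simp add: algebra_simps)
      then show ?thesis by blast
    qed
  qed
  then obtain g where g: "?I = {a * g | a. True}" by blast
  have "c = 1 * c + 0 * d" "d = 0 * c + 1 * d" by simp_all
  then have "c \<in> ?I" "d \<in> ?I" by blast+
  then have "g dvd c" "g dvd d" unfolding g by auto
  then have "g ^ 2 dvd c * d" by (simp add: power2_eq_square mult_dvd_mono)
  then have "g dvd 1" using assms by (auto simp: squarefree_def)
  then have "1 \<in> ?I" unfolding g by (auto simp: dvd_def mult.commute)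
  then show ?thesis by auto
qed

section \<open>Rules for the embedding and for the alternating form\<close>

context fraction_field
begin

lemma embed_zero [simp]: "\<iota> 0 = 0"
  using embed_add[of 0 0] by (metis add.right_neutral add_left_cancel)

lemma embed_uminus: "\<iota> (- a) = - \<iota> a"
  using embed_add[of a "- a"] by (simp add: eq_neg_iff_add_eq_0 add.commute)

lemma embed_eq_iff [simp]: "\<iota> a = \<iota> b \<longleftrightarrow> a = b"
  using embed_inj by (auto simp: inj_def)

lemma embed_eq_0_iff [simp]: "\<iota> a = 0 \<longleftrightarrow> a = 0"
  using embed_eq_iff[of a 0] by simp

end

context alternating_space
begin

lemma form_add_left: "form (u + u') v = form u v + form u' v"
  using module_hom.add[OF linear_left[of v, unfolded linear_iff_module_hom]] .

lemma form_add_right: "form u (v + v') = form u v + form u v'"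
  using module_hom.add[OF linear_right[of u, unfolded linear_iff_module_hom]] .

lemma form_scale_left: "form (scale c u) v = c * form u v"
  using module_hom.scale[OF linear_left[of v, unfolded linear_iff_module_hom]] .

lemma form_scale_right: "form u (scale c v) = c * form u v"
  using module_hom.scale[OF linear_right[of u, unfolded linear_iff_module_hom]] .

lemma form_zero_left [simp]: "form 0 v = 0"
  using form_scale_left[of 0 0 v] by simp

lemma form_zero_right [simp]: "form u 0 = 0"
  using form_scale_right[of u 0 0] by simp

lemma form_minus_left: "form (- u) v = - form u v"
  using form_scale_left[of "-1" u v] by simp

lemma form_minus_right: "form u (- v) = - form u v"
  using form_scale_right[of u "-1" v] by simp

lemma form_diff_left: "form (u - u') v = form u v - form u' v"
  using form_add_left[of u "- u'" v] by (simp add: form_minus_left)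

lemma form_diff_right: "form u (v - v') = form u v - form u v'"
  using form_add_right[of u v "- v'"] by (simp add: form_minus_right)

lemma form_sum_left: "form (sum g A) v = (\<Sum>i\<in>A. form (g i) v)"
  by (induction A rule: infinite_finite_induct) (auto simp: form_add_left)

lemma form_sum_right: "form u (sum g A) = (\<Sum>i\<in>A. form u (g i))"
  by (induction A rule: infinite_finite_induct) (auto simp: form_add_right)

lemma form_swap: "form u v = - form v u"
proof -
  have "form u v + form v u = 0"
    using alternating[of "u + v"] unfolding form_add_left form_add_right
    by (simp add: alternating add.commute)
  then show ?thesis by (simp add: eq_neg_iff_add_eq_0)
qed

lemma form_eq_0_commute: "form u v = 0 \<longleftrightarrow> form v u = 0"
  using form_swap[of u v] by simp

lemmas form_simps = form_add_left form_add_right form_diff_left form_diff_right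
  form_scale_left form_scale_right form_minus_left form_minus_right form_sum_left form_sum_right

lemma form_span_eq_0:
  assumes "x \<in> span S" and "\<And>s. s \<in> S \<Longrightarrow> form s v = 0"
  shows "form x v = 0"
  using assms by (induction rule: span_induct_alt) (auto simp: form_simps)

end

section \<open>Submodules over \<open>R\<close> and values of the form\<close>

locale alternating_R_space =
  fraction_field \<iota> + alternating_space scale form
  for \<iota> :: "'r::principal_ideal_domain \<Rightarrow> 'f::field"
    and scale :: "'f \<Rightarrow> 'v::ab_group_add \<Rightarrow> 'v"
    and form :: "'v \<Rightarrow> 'v \<Rightarrow> 'f"
begin

sublocale R: module "restrict_scale \<iota> scale"
  by unfold_locales
    (simp_all add: embed_add embed_mult embed_one scale_left_distrib scale_right_distrib)

lemma R_span_subset_span: "R.span S \<subseteq> span S"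
proof (rule R.span_minimal)
  show "R.subspace (span S)"
    by (auto simp: R.subspace_def span_zero span_add span_scale)
qed (rule span_superset)

lemma R_span_eq_0:
  assumes "x \<in> R.span S" and "\<And>s. s \<in> S \<Longrightarrow> form s v = 0"
  shows "form x v = 0"
  using form_span_eq_0[of x S v] R_span_subset_span[of S] assms by blast

text \<open>Coefficients are indexed by \<open>I\<close> rather than by vectors, so that elements of
  the span can be compared directly with the sums in \<open>pair_comb\<close>.\<close>

lemma R_span_image:
  assumes "finite I"
  shows "R.span (e ` I) = range (\<lambda>a. \<Sum>i\<in>I. scale (\<iota> (a i)) (e i))"
proof
  have "e i \<in> range (\<lambda>a. \<Sum>i\<in>I. scale (\<iota> (a i)) (e i))" if "i \<in> I" for i
    using that assms
    by (intro image_eqI[where x = "\<lambda>j. if j = i then 1 else 0"])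
      (simp_all add: if_distrib[of \<iota>] if_distribR if_distrib[of "\<lambda>c. scale c _"]
        embed_one sum.delta cong: if_cong)
  moreover have "R.subspace (range (\<lambda>a. \<Sum>i\<in>I. scale (\<iota> (a i)) (e i)))"
    unfolding R.subspace_def
  proof (intro conjI ballI allI)
    show "0 \<in> range (\<lambda>a. \<Sum>i\<in>I. scale (\<iota> (a i)) (e i))"
      by (intro image_eqI[where x = "\<lambda>_. 0"]) auto
  next
    fix x y
    assume "x \<in> range (\<lambda>a. \<Sum>i\<in>I. scale (\<iota> (a i)) (e i))"
      and "y \<in> range (\<lambda>a. \<Sum>i\<in>I. scale (\<iota> (a i)) (e i))"
    then obtain a b where "x = (\<Sum>i\<in>I. scale (\<iota> (a i)) (e i))"
      and "y = (\<Sum>i\<in>I. scale (\<iota> (b i)) (e i))" by blast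
    then have "x + y = (\<Sum>i\<in>I. scale (\<iota> (a i + b i)) (e i))"
      by (simp add: embed_add scale_left_distrib sum.distrib)
    then show "x + y \<in> range (\<lambda>a. \<Sum>i\<in>I. scale (\<iota> (a i)) (e i))"
      by (intro image_eqI[where x = "\<lambda>i. a i + b i"]) auto
  next
    fix x c
    assume "x \<in> range (\<lambda>a. \<Sum>i\<in>I. scale (\<iota> (a i)) (e i))"
    then obtain a where "x = (\<Sum>i\<in>I. scale (\<iota> (a i)) (e i))" by blast
    then have "scale (\<iota> c) x = (\<Sum>i\<in>I. scale (\<iota> (c * a i)) (e i))"
      by (simp add: embed_mult scale_sum_right)
    then show "scale (\<iota> c) x \<in> range (\<lambda>a. \<Sum>i\<in>I. scale (\<iota> (a i)) (e i))"
      by (intro image_eqI[where x = "\<lambda>i. c * a i"]) auto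
  qed
  ultimately show "R.span (e ` I) \<subseteq> range (\<lambda>a. \<Sum>i\<in>I. scale (\<iota> (a i)) (e i))"
    by (intro R.span_minimal) auto
  show "range (\<lambda>a. \<Sum>i\<in>I. scale (\<iota> (a i)) (e i)) \<subseteq> R.span (e ` I)"
    by (auto intro!: R.span_sum R.span_scale intro: R.span_base)
qed

text \<open>The \<open>a\<close> for which \<open>\<iota> a\<close> is a value of
  \<open>form z\<close> on \<open>A\<close> form an ideal, and its generator is itself such a value.
  Applied to the dual lattice it gives the factor to be divided out of a vector; applied to
  \<open>\<Lambda>\<close> it gives the divisor \<open>d\<close> of a pair.\<close>

lemma form_values_principal:
  assumes A: "R.subspace A" and int: "\<And>x. x \<in> A \<Longrightarrow> form z x \<in> range \<iota>"
  shows "\<exists>g. (\<exists>w\<in>A. form z w = \<iota> g) \<and> (\<forall>x\<in>A. \<exists>a. form z x = \<iota> (g * a))"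
proof -
  let ?I = "{a. \<exists>x\<in>A. form z x = \<iota> a}"
  have "\<exists>g. ?I = {a * g | a. True}"
  proof (rule ideal_principal)
    show "0 \<in> ?I" using R.subspace_0[OF A] by force
    show "a + b \<in> ?I" if "a \<in> ?I" "b \<in> ?I" for a b
      using that R.subspace_add[OF A] by (force simp: embed_add form_simps)
    show "c * a \<in> ?I" if "a \<in> ?I" for c a
      using that R.subspace_scale[OF A] by (force simp: embed_mult form_simps)
  qed
  then obtain g where g: "?I = {a * g | a. True}" by blast
  have "g \<in> ?I" unfolding g by (auto intro: exI[of _ 1])
  then obtain w where w: "w \<in> A" "form z w = \<iota> g" by blast
  have "\<exists>a. form z x = \<iota> (g * a)" if x: "x \<in> A" for x
  proof -
    from int[OF x] obtain b where b: "form z x = \<iota> b" by blast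
    then have "b \<in> ?I" using x by blast
    then show ?thesis unfolding g using b by (auto simp: mult.commute)
  qed
  with w show ?thesis by blast
qed

section \<open>Combinations of the vectors in a family of pairs\<close>

text \<open>The general element of \<open>M\<close> in terms of its coefficients in
  \<open>R\<close>. Two ordinary sums replace the sum over the disjoint union of index sets in
  \<open>pair_sum\<close>, so that coefficients can be read off with the form.\<close>

definition pair_comb :: "nat \<Rightarrow> (nat \<Rightarrow> 'v) \<Rightarrow> (nat \<Rightarrow> 'v) \<Rightarrow> (nat \<Rightarrow> 'r) \<Rightarrow> (nat \<Rightarrow> 'r) \<Rightarrow> 'v" where
  "pair_comb k e f a b =
    (\<Sum>i\<in>{1..k}. scale (\<iota> (a i)) (e i)) + (\<Sum>i\<in>{1..k}. scale (\<iota> (b i)) (f i))"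

text \<open>Each summand lies in the span of a single vector and is thus a multiple of it; the
  chosen multipliers are the coefficients.\<close>

lemma sum_pair_eq_pair_comb:
  assumes "\<forall>p\<in>{1..k} <+> {1..k}. x p \<in> R.span {case_sum e f p}"
  obtains a b where "\<And>i. i \<in> {1..k} \<Longrightarrow> x (Inl i) = scale (\<iota> (a i)) (e i)"
    and "\<And>i. i \<in> {1..k} \<Longrightarrow> x (Inr i) = scale (\<iota> (b i)) (f i)"
    and "(\<Sum>p\<in>{1..k} <+> {1..k}. x p) = pair_comb k e f a b"
proof -
  have "\<forall>p\<in>{1..k} <+> {1..k}. \<exists>c. x p = scale (\<iota> c) (case_sum e f p)"
    using assms by (auto simp: R.span_singleton)
  then obtain c where c: "\<And>p. p \<in> {1..k} <+> {1..k} \<Longrightarrow> x p = scale (\<iota> (c p)) (case_sum e f p)"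
    by metis
  have "x (Inl i) = scale (\<iota> (c (Inl i))) (e i)" "x (Inr i) = scale (\<iota> (c (Inr i))) (f i)"
    if "i \<in> {1..k}" for i
    using c[OF InlI[OF that]] c[OF InrI[OF that]] by simp_all
  with that[of "\<lambda>i. c (Inl i)" "\<lambda>i. c (Inr i)"] show ?thesis
    by (simp add: pair_comb_def sum.Plus)
qed

lemma pair_comb_range_eq:
  "{(\<Sum>p\<in>{1..k} <+> {1..k}. x p) | x. \<forall>p\<in>{1..k} <+> {1..k}. x p \<in> R.span {case_sum e f p}}
    = {pair_comb k e f a b | a b. True}"
proof (intro set_eqI iffI)
  fix v
  assume "v \<in> {pair_comb k e f a b | a b. True}"
  then obtain a b where v: "v = pair_comb k e f a b" by blast
  let ?x = "case_sum (\<lambda>i. scale (\<iota> (a i)) (e i)) (\<lambda>i. scale (\<iota> (b i)) (f i))"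
  have "v = (\<Sum>p\<in>{1..k} <+> {1..k}. ?x p)"
    by (simp add: v pair_comb_def sum.Plus)
  moreover have "\<forall>p\<in>{1..k} <+> {1..k}. ?x p \<in> R.span {case_sum e f p}"
    by (auto simp: R.span_singleton)
  ultimately show "v \<in> {(\<Sum>p\<in>{1..k} <+> {1..k}. x p) | x.
      \<forall>p\<in>{1..k} <+> {1..k}. x p \<in> R.span {case_sum e f p}}"
    by blast
qed (blast elim: sum_pair_eq_pair_comb)

lemma pair_sumD: "pair_sum \<iota> scale k e f M \<Longrightarrow> M = {pair_comb k e f a b | a b. True}"
  unfolding pair_sum_def internal_direct_sum_def pair_comb_range_eq by blast

lemma R_span_subset_pair_sum:
  assumes "M = {pair_comb k e f a b | a b. True}"
  shows "R.span (e ` {1..k}) \<subseteq> M"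
proof
  fix z
  assume "z \<in> R.span (e ` {1..k})"
  then obtain a where "z = (\<Sum>i\<in>{1..k}. scale (\<iota> (a i)) (e i))"
    unfolding R_span_image[OF finite_atLeastAtMost] by blast
  then have "z = pair_comb k e f a (\<lambda>_. 0)" by (simp add: pair_comb_def)
  then show "z \<in> M" unfolding assms by blast
qed

lemma pair_sumI:
  assumes "M = {pair_comb k e f a b | a b. True}"
    and "\<And>a b i. pair_comb k e f a b = 0 \<Longrightarrow> i \<in> {1..k} \<Longrightarrow> a i = 0 \<and> b i = 0"
  shows "pair_sum \<iota> scale k e f M"
  unfolding pair_sum_def internal_direct_sum_def pair_comb_range_eq
proof (intro conjI allI impI)
  fix x
  assume "(\<forall>p\<in>{1..k} <+> {1..k}. x p \<in> R.span {case_sum e f p})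
    \<and> (\<Sum>p\<in>{1..k} <+> {1..k}. x p) = 0"
  then show "\<forall>p\<in>{1..k} <+> {1..k}. x p = 0"
    using assms(2) by (elim conjE sum_pair_eq_pair_comb) auto
qed (use assms(1) in blast)

text \<open>Pairing with \<open>f j\<close> isolates the coefficient of \<open>e j\<close>, and
  pairing with \<open>e j\<close> that of \<open>f j\<close>, in both cases up to the factor
  \<open>d j\<close>. Coefficients are solved for, or shown to vanish, in this way.\<close>

lemma pair_comb_form:
  assumes "\<And>i j. i \<in> {1..k} \<Longrightarrow> j \<in> {1..k} \<Longrightarrow> form (e i) (e j) = 0"
    and "\<And>i j. i \<in> {1..k} \<Longrightarrow> j \<in> {1..k} \<Longrightarrow> form (f i) (f j) = 0"
    and "\<And>i j. i \<in> {1..k} \<Longrightarrow> j \<in> {1..k} \<Longrightarrow> form (e i) (f j) = (if i = j then \<iota> (d i) else 0)"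
    and "j \<in> {1..k}"
  shows "form (pair_comb k e f a b) (f j) = \<iota> (a j * d j)"
    and "form (e j) (pair_comb k e f a b) = \<iota> (b j * d j)"
proof -
  have "(\<Sum>i\<in>{1..k}. \<iota> (a i) * form (e i) (f j)) = (\<Sum>i\<in>{1..k}. if i = j then \<iota> (a j * d j) else 0)"
    by (rule sum.cong) (use assms in \<open>auto simp: embed_mult\<close>)
  moreover have "(\<Sum>i\<in>{1..k}. \<iota> (b i) * form (f i) (f j)) = 0"
    by (rule sum.neutral) (use assms in auto)
  ultimately show "form (pair_comb k e f a b) (f j) = \<iota> (a j * d j)"
    using assms(4) by (simp add: pair_comb_def form_simps)
  have "(\<Sum>i\<in>{1..k}. \<iota> (b i) * form (e j) (f i)) = (\<Sum>i\<in>{1..k}. if i = j then \<iota> (b j * d j) else 0)"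
    by (rule sum.cong) (use assms in \<open>auto simp: embed_mult\<close>)
  moreover have "(\<Sum>i\<in>{1..k}. \<iota> (a i) * form (e j) (e i)) = 0"
    by (rule sum.neutral) (use assms in auto)
  ultimately show "form (e j) (pair_comb k e f a b) = \<iota> (b j * d j)"
    using assms(4) by (simp add: pair_comb_def form_simps)
qed

section \<open>Submodules whose radical contains \<open>Z\<close>\<close>

text \<open>Write \<open>x \<in> X\<close> as an element of \<open>M\<close> plus an element of
  \<open>\<Lambda>'\<close>. Since \<open>x\<close> is orthogonal to every \<open>e j\<close>,
  pairing gives \<open>b j * d j = 0\<close>, and \<open>d j\<close> is nonzero as a divisor of
  \<open>N\<close>. So only the \<open>e\<close> part survives and the component in \<open>M\<close>
  lies in \<open>Z\<close>.\<close>

lemma adapted_splitting_radical: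
  assumes spl: "adapted_splitting \<iota> scale form N \<Lambda> Z r e f d M \<Lambda>'" and "N \<noteq> 0"
    and iso: "totally_isotropic form Z"
    and X: "R.subspace X" "X \<subseteq> \<Lambda>" "Z \<subseteq> X" "Z \<subseteq> radical form X"
  shows "orthogonal_sum form X Z (X \<inter> \<Lambda>')"
    and "nondegenerate_on form (X \<inter> \<Lambda>') \<longleftrightarrow> Z = radical form X"
proof -
  have sys: "adapted_system \<iota> scale form N \<Lambda> Z r e f d" and sum: "pair_sum \<iota> scale r e f M"
    and \<Lambda>': "R.subspace \<Lambda>'" and orth: "orthogonal_sum form \<Lambda> M \<Lambda>'"
    using spl unfolding adapted_splitting_def by blast+
  note M = pair_sumD[OF sum]
  have Zspan: "Z = R.span (e ` {1..r})" and ff: "totally_isotropic form (R.span (f ` {1..r}))"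
    and ef: "\<And>i j. i \<in> {1..r} \<Longrightarrow> j \<in> {1..r} \<Longrightarrow> form (e i) (f j) = (if i = j then \<iota> (d i) else 0)"
    and dN: "\<And>i. i \<in> {1..r} \<Longrightarrow> d i dvd N"
    using sys unfolding adapted_system_def R_basis_on_def by auto
  have eZ: "e i \<in> Z" if "i \<in> {1..r}" for i
    unfolding Zspan using that by (intro R.span_base) auto
  have ee: "form (e i) (e j) = 0" if "i \<in> {1..r}" "j \<in> {1..r}" for i j
    using iso eZ that unfolding totally_isotropic_def by blast
  have ff': "form (f i) (f j) = 0" if "i \<in> {1..r}" "j \<in> {1..r}" for i j
  proof -
    have "f i \<in> R.span (f ` {1..r})" "f j \<in> R.span (f ` {1..r})"
      using that by (auto intro!: R.span_base)
    then show ?thesis using ff unfolding totally_isotropic_def by blast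
  qed
  have ZM: "Z \<subseteq> M"
    unfolding Zspan by (rule R_span_subset_pair_sum[OF M])
  have disj: "M \<inter> \<Lambda>' = {0}" and M\<Lambda>': "\<And>x y. x \<in> M \<Longrightarrow> y \<in> \<Lambda>' \<Longrightarrow> form x y = 0"
    and \<Lambda>: "\<Lambda> = {a + b | a b. a \<in> M \<and> b \<in> \<Lambda>'}"
    using orth unfolding orthogonal_sum_def by blast+
  have Z: "R.subspace Z" unfolding Zspan by simp
  have dec: "\<exists>z\<in>Z. \<exists>y\<in>X \<inter> \<Lambda>'. x = z + y" if x: "x \<in> X" for x
  proof -
    from x X(2) \<Lambda> M obtain a b y where y: "x = pair_comb r e f a b + y" "y \<in> \<Lambda>'" by blast
    have "b j = 0" if j: "j \<in> {1..r}" for j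
    proof -
      have "form (e j) x = 0" using eZ[OF j] X(4) x unfolding radical_def by blast
      moreover have "form (e j) y = 0" using eZ[OF j] ZM M\<Lambda>' y(2) by blast
      ultimately have "form (e j) (pair_comb r e f a b) = 0" using y(1) by (simp add: form_simps)
      then have "b j * d j = 0" using pair_comb_form(2)[OF ee ff' ef j] by simp
      then show ?thesis using dN[OF j] \<open>N \<noteq> 0\<close> by auto
    qed
    then have "pair_comb r e f a b = (\<Sum>i\<in>{1..r}. scale (\<iota> (a i)) (e i))"
      by (simp add: pair_comb_def)
    then have z: "pair_comb r e f a b \<in> Z"
      unfolding Zspan R_span_image[OF finite_atLeastAtMost] by blast
    then have "x - pair_comb r e f a b \<in> X" using X x R.subspace_diff by blast
    then have "y \<in> X" using y by simp
    with z y show ?thesis by blast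
  qed
  have sumX: "z + y \<in> X" if "z \<in> Z" "y \<in> X \<inter> \<Lambda>'" for z y
    using that X R.subspace_add by blast
  have ZX'0: "Z \<inter> (X \<inter> \<Lambda>') = {0}"
    using disj ZM R.subspace_0[OF Z] R.subspace_0[OF X(1)] R.subspace_0[OF \<Lambda>'] by blast
  show "orthogonal_sum form X Z (X \<inter> \<Lambda>')"
    unfolding orthogonal_sum_def
    using dec sumX ZX'0 ZM M\<Lambda>' by (intro conjI set_eqI) blast+
  \<comment> \<open>\<open>X\<close> is the sum of \<open>Z\<close> and
    \<open>X \<inter> \<Lambda>'\<close>: orthogonality to the first holds because \<open>Z\<close>
    lies in the radical of \<open>X\<close>, orthogonality to the second by the choice of
    \<open>x\<close>.\<close>
  have radX: "x \<in> radical form X" if "x \<in> radical form (X \<inter> \<Lambda>')" for x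
  proof -
    have "form x y = 0" if "y \<in> X" for y
    proof -
      from dec[OF that] obtain z y' where zy: "z \<in> Z" "y' \<in> X \<inter> \<Lambda>'" "y = z + y'" by blast
      have "form z x = 0" using zy(1) X(4) \<open>x \<in> radical form (X \<inter> \<Lambda>')\<close> unfolding radical_def by blast
      then have "form x z = 0" by (simp add: form_eq_0_commute)
      moreover have "form x y' = 0" using zy(2) \<open>x \<in> radical form (X \<inter> \<Lambda>')\<close> unfolding radical_def by blast
      ultimately show ?thesis using zy(3) by (simp add: form_simps)
    qed
    then show ?thesis using \<open>x \<in> radical form (X \<inter> \<Lambda>')\<close> unfolding radical_def by blast
  qed
  show "nondegenerate_on form (X \<inter> \<Lambda>') \<longleftrightarrow> Z = radical form X"
  proof
    assume nd: "nondegenerate_on form (X \<inter> \<Lambda>')"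
    have "x \<in> Z" if x: "x \<in> radical form X" for x
    proof -
      have "x \<in> X" using x unfolding radical_def by blast
      from dec[OF this] obtain z y where zy: "z \<in> Z" "y \<in> X \<inter> \<Lambda>'" "x = z + y" by blast
      \<comment> \<open>Both \<open>x\<close> and \<open>z\<close> lie in the radical of
        \<open>X\<close>, hence so does their difference \<open>y\<close>; nondegeneracy will then
        leave \<open>y = 0\<close> and \<open>x = z\<close>.\<close>
      have "form y u = 0" if "u \<in> X" for u
        using x zy X(4) that unfolding radical_def by (auto simp: form_simps)
      then have "y \<in> radical form (X \<inter> \<Lambda>')" using zy(2) unfolding radical_def by blast
      then show ?thesis using nd zy unfolding nondegenerate_on_def by auto
    qed
    then show "Z = radical form X" using X(4) by blast
  next
    assume Zrad: "Z = radical form X"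
    have "radical form (X \<inter> \<Lambda>') \<subseteq> Z \<inter> (X \<inter> \<Lambda>')"
      using radX Zrad unfolding radical_def[of form "X \<inter> \<Lambda>'"] by blast
    moreover have "0 \<in> radical form (X \<inter> \<Lambda>')"
      using ZX'0 unfolding radical_def by auto
    ultimately show "nondegenerate_on form (X \<inter> \<Lambda>')"
      unfolding nondegenerate_on_def using ZX'0 by blast
  qed
qed

end

section \<open>The dual lattice and the construction of one pair\<close>

locale alternating_lattice =
  alternating_R_space \<iota> scale form + finite_dimensional_vector_space scale Basis
  for \<iota> :: "'r::principal_ideal_domain \<Rightarrow> 'f::field"
    and scale :: "'f \<Rightarrow> 'v::ab_group_add \<Rightarrow> 'v"
    and form :: "'v \<Rightarrow> 'v \<Rightarrow> 'f" and Basis +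
  fixes N :: 'r and m :: nat and \<Lambda> :: "'v set"
  assumes dim_space: "dim UNIV = 2 * m"
    and squarefree_N: "squarefree N"
    and lattice: "R_lattice \<iota> scale m \<Lambda>"
    and integral: "integral_on \<iota> form \<Lambda>"
    and level: "level_dvd \<iota> scale form \<Lambda> N"
begin

abbreviation dual :: "'v set" where "dual \<equiv> dual_lattice \<iota> form \<Lambda>"

lemma N_nonzero: "N \<noteq> 0"
  using squarefree_N by auto

lemma span_lattice: "span \<Lambda> = UNIV"
  using lattice unfolding R_lattice_def by blast

lemma lattice_submodule: "R.subspace \<Lambda>"
  using lattice unfolding R_lattice_def R_basis_on_def by blast

lemma dual_submodule: "R.subspace dual"
proof -
  have "0 \<in> range \<iota>"
    by (rule image_eqI[of _ _ 0]) auto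
  moreover have "x + y \<in> range \<iota>" "x * y \<in> range \<iota>" if "x \<in> range \<iota>" "y \<in> range \<iota>" for x y
    using that by (auto simp: embed_add[symmetric] embed_mult[symmetric])
  ultimately show ?thesis
    by (auto simp: R.subspace_def dual_lattice_def form_simps)
qed

lemma dualD: "w \<in> dual \<Longrightarrow> x \<in> \<Lambda> \<Longrightarrow> \<exists>a. form w x = \<iota> a"
  unfolding dual_lattice_def by blast

lemma dualD': "w \<in> dual \<Longrightarrow> x \<in> \<Lambda> \<Longrightarrow> form x w \<in> range \<iota>"
  using dualD[of w x] by (metis form_swap embed_uminus rangeI)

lemma lattice_subset_dual: "\<Lambda> \<subseteq> dual"
  using integral unfolding integral_on_def dual_lattice_def by blast

lemma form_lattice_eq_0:
  assumes "\<And>x. x \<in> \<Lambda> \<Longrightarrow> form z x = 0"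
  shows "z = 0"
proof (rule nondegenerate_form)
  fix w
  have "form w z = 0"
    using assms span_lattice by (intro form_span_eq_0[of w \<Lambda>]) (auto simp: form_eq_0_commute[of _ z])
  then show "form z w = 0" by (simp add: form_eq_0_commute)
qed

text \<open>The dual basis of an \<open>R\<close>-basis of \<open>\<Lambda>\<close> lies in
  \<open>dual\<close>, and pairing \<open>x\<close> with it yields the coordinates of
  \<open>x\<close>, which are therefore in \<open>R\<close>. This is what allows a vector to be
  divided by a common factor of its values on \<open>dual\<close> without leaving
  \<open>\<Lambda>\<close>.\<close>

lemma double_dual:
  assumes "\<And>w. w \<in> dual \<Longrightarrow> form x w \<in> range \<iota>"
  shows "x \<in> \<Lambda>"
proof -
  obtain b where b: "inj_on b {1..2 * m}" "R.span (b ` {1..2 * m}) = \<Lambda>"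
    using lattice unfolding R_lattice_def R_basis_on_def by blast
  define B where "B = b ` {1..2 * m}"
  have finB: "finite B" and cardB: "card B = 2 * m" and \<Lambda>: "\<Lambda> = R.span B"
    using b by (auto simp: B_def card_image)
  have spanB: "span B = UNIV"
    using span_lattice \<Lambda> R_span_subset_span[of B] span_minimal[OF _ subspace_span, of \<Lambda> B] by blast
  \<comment> \<open>A spanning set of \<open>2 * m\<close> vectors in a space of dimension
    \<open>2 * m\<close> is independent over \<open>F\<close>.\<close>
  then have indB: "independent B"
    using card_le_dim_spanning[of B UNIV] finB cardB dim_space by simp
  have coeff0: "c u = 0" if "(\<Sum>v\<in>B. scale (c v) v) = 0" "u \<in> B" for c u
    using indB that dependent_finite[OF finB] by blast
  \<comment> \<open>The values of the form on \<open>B\<close> are packed into an endomorphism so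
    that injectivity, which follows from nondegeneracy, gives surjectivity. Comparing coefficients
    in \<open>T w = u\<close> shows that a preimage \<open>w\<close> of \<open>u\<close> is the dual
    basis vector belonging to \<open>u\<close>.\<close>
  define T where "T v = (\<Sum>u\<in>B. scale (form u v) u)" for v
  have T: "Vector_Spaces.linear scale scale T"
    by (auto simp: linear_iff_module_hom module_hom_iff module_axioms T_def form_simps scale_left_distrib
        sum.distrib scale_sum_right)
  have "inj T"
  proof (rule injI)
    fix v v'
    assume "T v = T v'"
    then have "(\<Sum>u\<in>B. scale (form u (v - v')) u) = 0"
      by (simp add: T_def form_simps scale_left_diff_distrib sum_subtractf)
    then have "form u (v - v') = 0" if "u \<in> B" for u
      using coeff0[of "\<lambda>u. form u (v - v')"] that by blast
    then have "form w (v - v') = 0" for w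
      using form_span_eq_0[of w B] spanB by blast
    then have "v - v' = 0"
      by (intro nondegenerate_form) (simp add: form_eq_0_commute[of "v - v'"])
    then show "v = v'" by simp
  qed
  with T have "surj T" by (rule linear_inj_imp_surj)
  have ex_dual: "\<exists>w\<in>dual. \<forall>u'\<in>B. form u' w = (if u' = u then 1 else 0)" if u: "u \<in> B" for u
  proof -
    obtain w where w: "T w = u" using \<open>surj T\<close> by (metis surjD)
    have "(\<Sum>v\<in>B. scale (form v w - (if v = u then 1 else 0)) v) = T w - (\<Sum>v\<in>B. if v = u then v else 0)"
      by (auto simp: T_def scale_left_diff_distrib sum_subtractf intro!: sum.cong)
    also have "\<dots> = 0" using u finB w by simp
    finally have form: "form v w = (if v = u then 1 else 0)" if "v \<in> B" for v
      using coeff0[of "\<lambda>v. form v w - (if v = u then 1 else 0)"] that by fastforce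
    have "form y w \<in> range \<iota>" if "y \<in> R.span B" for y
      using that
    proof (induction rule: R.span_induct_alt)
      case base
      then show ?case by (auto intro: image_eqI[of _ _ 0])
    next
      case (step c v y)
      then obtain a where "form y w = \<iota> a" by blast
      with step(1) form[of v] show ?case
        by (auto simp: form_simps embed_add[symmetric])
    qed
    then have "form w y \<in> range \<iota>" if "y \<in> \<Lambda>" for y
      using that \<Lambda> by (metis form_swap embed_uminus rangeE rangeI)
    then show ?thesis using form unfolding dual_lattice_def by blast
  qed
  have "x \<in> span B" using spanB by blast
  then obtain c where c: "x = (\<Sum>v\<in>B. scale (c v) v)"
    unfolding span_finite[OF finB] by blast
  have "scale (c u) u \<in> R.span B" if u: "u \<in> B" for u
  proof -
    obtain w where w: "w \<in> dual" "\<forall>u'\<in>B. form u' w = (if u' = u then 1 else 0)"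
      using ex_dual[OF u] by blast
    have "form x w = (\<Sum>v\<in>B. if v = u then c v else 0)"
      unfolding c form_simps using w(2) by (intro sum.cong) auto
    also have "\<dots> = c u" using u finB by simp
    finally obtain a where "c u = \<iota> a" using assms[OF w(1)] by auto
    then show ?thesis using u by (auto intro: R.span_scale R.span_base)
  qed
  then show ?thesis unfolding \<Lambda> c by (intro R.span_sum)
qed

text \<open>Dividing \<open>z\<close> by the generator of the ideal \<open>form z ` dual\<close> makes it primitive.\<close>
lemma adapted_pair_exists:
  assumes z: "z \<in> \<Lambda>" "z \<noteq> 0"
  obtains c e f d where "c \<noteq> 0" "z = scale (\<iota> c) e" "e \<in> \<Lambda>" "f \<in> \<Lambda>" "d dvd N" "form e f = \<iota> d"
    "\<forall>x\<in>\<Lambda>. \<exists>a. form e x = \<iota> (d * a)" "\<forall>x\<in>\<Lambda>. \<exists>a. form f x = \<iota> (d * a)"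
proof -
  obtain g w where w: "w \<in> dual" "form z w = \<iota> g"
    and g: "\<And>x. x \<in> dual \<Longrightarrow> \<exists>a. form z x = \<iota> (g * a)"
    using form_values_principal[OF dual_submodule dualD'[OF _ z(1)]] by blast
  have "g \<noteq> 0"
    using form_lattice_eq_0[of z] g lattice_subset_dual z(2) by fastforce
  define e where "e = scale (inverse (\<iota> g)) z"
  \<comment> \<open>All values of \<open>form z\<close> on \<open>dual\<close> are divisible by
    \<open>g\<close>, so \<open>e\<close> still has integral values there.\<close>
  have e: "e \<in> \<Lambda>"
  proof (rule double_dual)
    fix x
    assume "x \<in> dual"
    then obtain a where "form z x = \<iota> (g * a)" using g by blast
    then show "form e x \<in> range \<iota>"
      using \<open>g \<noteq> 0\<close> by (simp add: e_def form_simps embed_mult mult.assoc[symmetric])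
  qed
  have ze: "z = scale (\<iota> g) e" and ew: "form e w = 1"
    using \<open>g \<noteq> 0\<close> w(2) by (simp_all add: e_def form_simps)
  obtain d y where y: "y \<in> \<Lambda>" "form e y = \<iota> d"
    and d: "\<And>x. x \<in> \<Lambda> \<Longrightarrow> \<exists>a. form e x = \<iota> (d * a)"
    using form_values_principal[OF lattice_submodule dualD'[OF subsetD[OF lattice_subset_dual] e]]
    by blast
  have "d \<noteq> 0"
    using form_lattice_eq_0[of e] d ze z(2) by fastforce
  have "scale (inverse (\<iota> d)) e \<in> dual"
    unfolding dual_lattice_def
  proof (intro CollectI ballI)
    fix x
    assume "x \<in> \<Lambda>"
    then obtain a where "form e x = \<iota> (d * a)" using d by blast
    then show "form (scale (inverse (\<iota> d)) e) x \<in> range \<iota>"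
      using \<open>d \<noteq> 0\<close> by (simp add: form_simps embed_mult mult.assoc[symmetric])
  qed
  then have "scale (\<iota> N) (scale (inverse (\<iota> d)) e) \<in> \<Lambda>"
    using level unfolding level_dvd_def by blast
  \<comment> \<open>The vector \<open>N e / d\<close> lies in \<open>\<Lambda>\<close>, and its
    value against \<open>w\<close> is \<open>N / d\<close> because
    \<open>form e w = 1\<close>.\<close>
  from dualD'[OF w(1) this] obtain d' where "\<iota> N * inverse (\<iota> d) = \<iota> d'"
    using ew by (auto simp: form_simps)
  then have "\<iota> N = \<iota> (d * d')"
    using \<open>d \<noteq> 0\<close> by (simp add: embed_mult field_simps)
  then have N: "N = d * d'" by simp
  obtain a b where ab: "a * d + b * d' = 1"
    using squarefree_mult_bezout squarefree_N unfolding N by blast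
  define f where "f = scale (\<iota> b) (scale (\<iota> N) w) + scale (\<iota> (a * d)) y"
  have "scale (\<iota> N) w \<in> \<Lambda>"
    using level w(1) unfolding level_dvd_def by blast
  then have f: "f \<in> \<Lambda>"
    unfolding f_def using lattice_submodule y(1) by (metis R.subspace_add R.subspace_scale)
  have "form e f = \<iota> (d * (a * d + b * d'))"
    unfolding f_def form_simps ew y(2) N embed_mult embed_add by (simp add: algebra_simps)
  then have "form e f = \<iota> d" using ab by simp
  moreover have "\<forall>x\<in>\<Lambda>. \<exists>a. form f x = \<iota> (d * a)"
  proof
    fix x
    assume x: "x \<in> \<Lambda>"
    obtain p where p: "form w x = \<iota> p" using dualD[OF w(1) x] by blast
    obtain q where q: "form y x = \<iota> q" using dualD x y(1) lattice_subset_dual by blast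
    \<comment> \<open>The first summand of \<open>f\<close> contributes the factor
      \<open>N = d * d'\<close>, and the second was given the coefficient \<open>a * d\<close>; this
      is why both parts have values divisible by \<open>d\<close>.\<close>
    have "form f x = \<iota> (d * (b * d' * p + a * q))"
      unfolding f_def form_simps p q N embed_mult embed_add by (simp add: algebra_simps)
    then show "\<exists>a. form f x = \<iota> (d * a)" by blast
  qed
  moreover have "d dvd N" by (simp add: N)
  moreover have "\<forall>x\<in>\<Lambda>. \<exists>a. form e x = \<iota> (d * a)" using d by blast
  ultimately show ?thesis
    by (intro that[OF \<open>g \<noteq> 0\<close> ze e f])
qed

section \<open>Systems of pairs: projection and extension\<close>

text \<open>This is the invariant of the induction. The divisibility of the values on
  \<open>\<Lambda>\<close> by \<open>d i\<close> is what makes the orthogonal projection onto the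
  pairs have coefficients in \<open>R\<close>. That the \<open>e i\<close> form a basis of
  \<open>Z\<close> is deduced only once their number equals the rank.\<close>

definition hyperbolic_system :: "nat \<Rightarrow> (nat \<Rightarrow> 'v) \<Rightarrow> (nat \<Rightarrow> 'v) \<Rightarrow> (nat \<Rightarrow> 'r) \<Rightarrow> bool" where
  "hyperbolic_system k e f d \<longleftrightarrow>
    (\<forall>i\<in>{1..k}. e i \<in> \<Lambda> \<and> f i \<in> \<Lambda> \<and> d i dvd N \<and>
      (\<forall>x\<in>\<Lambda>. \<exists>a. form (e i) x = \<iota> (d i * a)) \<and> (\<forall>x\<in>\<Lambda>. \<exists>a. form (f i) x = \<iota> (d i * a))) \<and>
    (\<forall>i\<in>{1..k}. \<forall>j\<in>{1..k}. form (e i) (e j) = 0 \<and> form (f i) (f j) = 0 \<and>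
      form (e i) (f j) = (if i = j then \<iota> (d i) else 0))"

context
  fixes k e f d
  assumes sys: "hyperbolic_system k e f d"
begin

lemma system_in_lattice: "i \<in> {1..k} \<Longrightarrow> e i \<in> \<Lambda>" "i \<in> {1..k} \<Longrightarrow> f i \<in> \<Lambda>"
  using sys unfolding hyperbolic_system_def by blast+

lemma system_divisor: "i \<in> {1..k} \<Longrightarrow> d i dvd N" "i \<in> {1..k} \<Longrightarrow> d i \<noteq> 0"
proof -
  show "d i dvd N" if "i \<in> {1..k}" for i
    using sys that unfolding hyperbolic_system_def by blast
  then show "i \<in> {1..k} \<Longrightarrow> d i \<noteq> 0" for i
    using N_nonzero by (metis dvd_0_left)
qed

lemma system_form:
  assumes "i \<in> {1..k}" "j \<in> {1..k}"
  shows "form (e i) (e j) = 0" "form (f i) (f j) = 0"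
    "form (e i) (f j) = (if i = j then \<iota> (d i) else 0)"
  using sys assms unfolding hyperbolic_system_def by blast+

lemmas system_form_pair_comb = pair_comb_form[OF system_form]

lemma pair_comb_in_lattice: "pair_comb k e f a b \<in> \<Lambda>"
  unfolding pair_comb_def
  by (intro R.subspace_add R.subspace_sum R.subspace_scale lattice_submodule system_in_lattice)

lemma pair_comb_orthogonal:
  assumes "\<And>j. j \<in> {1..k} \<Longrightarrow> form (e j) y = 0" "\<And>j. j \<in> {1..k} \<Longrightarrow> form (f j) y = 0"
  shows "form (pair_comb k e f a b) y = 0"
  using assms by (simp add: pair_comb_def form_simps)

text \<open>Orthogonal projection onto the pairs, with coefficients obtained by dividing the values
  at \<open>x\<close> by \<open>d j\<close>. The last clause serves vectors of a totally isotropic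
  \<open>Z\<close>, whose projection must involve no \<open>f j\<close>.\<close>

lemma pair_comb_projection:
  assumes "x \<in> \<Lambda>"
  shows "\<exists>a b. \<forall>j\<in>{1..k}. form (e j) (x - pair_comb k e f a b) = 0 \<and>
    form (f j) (x - pair_comb k e f a b) = 0 \<and> (form (e j) x = 0 \<longrightarrow> b j = 0)"
proof -
  have "\<forall>j\<in>{1..k}. \<exists>b. form (e j) x = \<iota> (d j * b)" "\<forall>j\<in>{1..k}. \<exists>a. form (f j) x = \<iota> (d j * a)"
    using sys assms unfolding hyperbolic_system_def by blast+
  then obtain a b where b: "\<And>j. j \<in> {1..k} \<Longrightarrow> form (e j) x = \<iota> (d j * b j)"
    and a: "\<And>j. j \<in> {1..k} \<Longrightarrow> form (f j) x = \<iota> (d j * a j)"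
    by metis
  \<comment> \<open>The sign comes from \<open>form (f j) (e j)\<close> being the negative of
    \<open>\<iota> (d j)\<close>.\<close>
  let ?h = "pair_comb k e f (\<lambda>j. - a j) b"
  have "form (e j) (x - ?h) = 0" "form (f j) (x - ?h) = 0" if j: "j \<in> {1..k}" for j
    using system_form_pair_comb[OF _ _ _ _ _ _ j, of "\<lambda>j. - a j" b] a[OF j] b[OF j]
      form_swap[of "f j" ?h]
    by (simp_all add: form_simps mult.commute embed_uminus)
  moreover have "b j = 0" if "j \<in> {1..k}" "form (e j) x = 0" for j
    using that b[of j] system_divisor(2)[of j] by simp
  ultimately show ?thesis by blast
qed

text \<open>The coefficients here are in \<open>F\<close>, in contrast to
  \<open>pair_comb_form\<close>. This covers both the independence of the \<open>e i\<close> over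
  \<open>F\<close> and the comparison of \<open>Z\<close> with their span over
  \<open>F\<close>.\<close>

lemma system_coefficients_eq_0:
  assumes "\<And>j. j \<in> {1..k} \<Longrightarrow> form (\<Sum>i\<in>{1..k}. scale (c i) (e i)) (f j) = 0" and j: "j \<in> {1..k}"
  shows "c j = 0"
proof -
  have "form (\<Sum>i\<in>{1..k}. scale (c i) (e i)) (f j) = (\<Sum>i\<in>{1..k}. if i = j then c j * \<iota> (d j) else 0)"
    unfolding form_simps by (rule sum.cong) (auto simp: system_form(3)[OF _ j])
  also have "\<dots> = c j * \<iota> (d j)" using j by simp
  finally show ?thesis using assms system_divisor(2)[OF j] by simp
qed

lemma system_inj_on: "inj_on e {1..k}"
proof (rule inj_onI)
  fix i j
  assume ij: "i \<in> {1..k}" "j \<in> {1..k}" "e i = e j"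
  then have "form (e j) (f i) \<noteq> 0"
    using system_form(3)[of i i] system_divisor(2)[of i] by simp
  then show "i = j" using system_form(3)[OF ij(2,1)] by presburger
qed

lemma system_independent: "independent (e ` {1..k})"
proof -
  have "u (e j) = 0" if "(\<Sum>v\<in>e ` {1..k}. scale (u v) v) = 0" "j \<in> {1..k}" for u j
  proof (rule system_coefficients_eq_0[OF _ that(2)])
    have "(\<Sum>i\<in>{1..k}. scale (u (e i)) (e i)) = 0"
      using that(1) unfolding sum.reindex[OF system_inj_on] by (simp add: comp_def)
    then show "form (\<Sum>i\<in>{1..k}. scale (u (e i)) (e i)) (f i) = 0" for i
      by (simp only: form_zero_left)
  qed
  then show ?thesis using dependent_finite[of "e ` {1..k}"] by auto
qed

text \<open>As \<open>z\<close> and all \<open>e j\<close> lie in the totally isotropic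
  \<open>Z\<close>, the \<open>f\<close> coefficients of the projection vanish. The projection is
  then an \<open>R\<close>-combination of the \<open>e j\<close>, so that subtracting it does not
  lead out of \<open>Z\<close>.\<close>

lemma isotropic_projection:
  assumes Z: "R.subspace Z" "Z \<subseteq> \<Lambda>" "totally_isotropic form Z" "e ` {1..k} \<subseteq> Z" and z: "z \<in> Z"
  obtains h where "h \<in> R.span (e ` {1..k})" "z - h \<in> Z"
    "\<And>j. j \<in> {1..k} \<Longrightarrow> form (e j) (z - h) = 0" "\<And>j. j \<in> {1..k} \<Longrightarrow> form (f j) (z - h) = 0"
proof -
  have "z \<in> \<Lambda>" using Z z by blast
  then obtain a b where ab: "\<And>j. j \<in> {1..k} \<Longrightarrow> form (e j) (z - pair_comb k e f a b) = 0"
      "\<And>j. j \<in> {1..k} \<Longrightarrow> form (f j) (z - pair_comb k e f a b) = 0"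
      "\<And>j. j \<in> {1..k} \<Longrightarrow> form (e j) z = 0 \<Longrightarrow> b j = 0"
    using pair_comb_projection[OF \<open>z \<in> \<Lambda>\<close>] by blast
  have "b j = 0" if "j \<in> {1..k}" for j
    using ab(3)[OF that] Z z that unfolding totally_isotropic_def by blast
  then have "pair_comb k e f a b = (\<Sum>i\<in>{1..k}. scale (\<iota> (a i)) (e i))"
    by (simp add: pair_comb_def)
  then have h: "pair_comb k e f a b \<in> R.span (e ` {1..k})"
    unfolding R_span_image[OF finite_atLeastAtMost] by blast
  then have "pair_comb k e f a b \<in> Z" using R.span_minimal[OF Z(4,1)] by blast
  then have "z - pair_comb k e f a b \<in> Z" using R.subspace_diff[OF Z(1) z] by blast
  with h ab show ?thesis using that by blast
qed

text \<open>A vector of \<open>Z\<close> is projected away from the old pairs and made primitive,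
  which gives \<open>e'\<close>; its partner \<open>f'\<close> is then projected as well. It remains
  to see that \<open>e'\<close> stays in \<open>Z\<close> and that the projected partner keeps its
  values divisible by \<open>d'\<close>.\<close>

lemma hyperbolic_system_extend:
  assumes Z: "R.subspace Z" "Z \<subseteq> \<Lambda>" "primitive_in scale \<Lambda> Z" "totally_isotropic form Z"
    and eZ: "e ` {1..k} \<subseteq> Z" and rank: "k < R_rank scale Z"
  shows "\<exists>e f d. hyperbolic_system (Suc k) e f d \<and> e ` {1..Suc k} \<subseteq> Z"
proof -
  \<comment> \<open>A vector of \<open>Z\<close> outside this span remains nonzero after subtraction
    of its projection, which lies in the span.\<close>
  have "\<not> Z \<subseteq> span (e ` {1..k})"
  proof
    assume "Z \<subseteq> span (e ` {1..k})"
    then have "dim Z \<le> card (e ` {1..k})" by (rule dim_le_card) simp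
    also have "\<dots> \<le> k" using card_image_le[of "{1..k}" e] by simp
    finally show False using rank by (simp add: R_rank_def)
  qed
  then obtain z0 where z0: "z0 \<in> Z" "z0 \<notin> span (e ` {1..k})" by blast
  obtain h where h: "h \<in> R.span (e ` {1..k})" "z0 - h \<in> Z"
    "\<And>j. j \<in> {1..k} \<Longrightarrow> form (e j) (z0 - h) = 0" "\<And>j. j \<in> {1..k} \<Longrightarrow> form (f j) (z0 - h) = 0"
    using isotropic_projection[OF Z(1,2,4) eZ z0(1)] by blast
  have "z0 - h \<in> \<Lambda>" using h(2) Z(2) by blast
  moreover have "z0 - h \<noteq> 0" using h(1) z0(2) R_span_subset_span by auto
  ultimately obtain c e' f' d' where c: "c \<noteq> 0" "z0 - h = scale (\<iota> c) e'"
    and e': "e' \<in> \<Lambda>" and f': "f' \<in> \<Lambda>" and d': "d' dvd N" "form e' f' = \<iota> d'"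
    and e'_values: "\<forall>x\<in>\<Lambda>. \<exists>a. form e' x = \<iota> (d' * a)"
    and f'_values: "\<forall>x\<in>\<Lambda>. \<exists>a. form f' x = \<iota> (d' * a)"
    by (rule adapted_pair_exists)
  have "e' = scale (inverse (\<iota> c)) (z0 - h)" using c by simp
  then have "e' \<in> span Z" using h(2) by (auto intro: span_scale span_base)
  then have e'Z: "e' \<in> Z" using e' Z(3) unfolding primitive_in_def by blast
  have ee': "form (e j) e' = 0" "form (f j) e' = 0" if "j \<in> {1..k}" for j
    using h(3,4)[OF that] c by (auto simp: form_simps)
  obtain a b where ab: "\<And>j. j \<in> {1..k} \<Longrightarrow> form (e j) (f' - pair_comb k e f a b) = 0"
      "\<And>j. j \<in> {1..k} \<Longrightarrow> form (f j) (f' - pair_comb k e f a b) = 0"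
    using pair_comb_projection[OF f'] by blast
  define f'' where "f'' = f' - pair_comb k e f a b"
  have f'': "f'' \<in> \<Lambda>"
    unfolding f''_def by (intro R.subspace_diff lattice_submodule f' pair_comb_in_lattice)
  have ef'': "form (e j) f'' = 0" "form (f j) f'' = 0" if "j \<in> {1..k}" for j
    using ab that unfolding f''_def by blast+
  have "form (pair_comb k e f a b) e' = 0" by (rule pair_comb_orthogonal) (use ee' in auto)
  then have e'f'': "form e' f'' = \<iota> d'"
    using d'(2) by (simp add: f''_def form_simps form_eq_0_commute[of e'])
  have f''_values: "\<exists>a. form f'' x = \<iota> (d' * a)" if x: "x \<in> \<Lambda>" for x
  proof -
    obtain p q where pq: "\<And>j. j \<in> {1..k} \<Longrightarrow> form (e j) (x - pair_comb k e f p q) = 0"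
      "\<And>j. j \<in> {1..k} \<Longrightarrow> form (f j) (x - pair_comb k e f p q) = 0"
      using pair_comb_projection[OF x] by blast
    have "x - pair_comb k e f p q \<in> \<Lambda>"
      by (intro R.subspace_diff lattice_submodule x pair_comb_in_lattice)
    then obtain t where t: "form f' (x - pair_comb k e f p q) = \<iota> (d' * t)" using f'_values by blast
    have "form (pair_comb k e f p q) f'' = 0"
      by (rule pair_comb_orthogonal) (use ef'' in auto)
    then have "form f'' (pair_comb k e f p q) = 0" by (simp add: form_eq_0_commute)
    then have "form f'' x = form f'' (x - pair_comb k e f p q)" by (simp add: form_diff_right)
    also have "\<dots> = form f' (x - pair_comb k e f p q)"
      using pair_comb_orthogonal[OF pq, of a b] by (simp add: f''_def form_diff_left)
    finally show ?thesis using t by auto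
  qed
  have "hyperbolic_system (Suc k) (e(Suc k := e')) (f(Suc k := f'')) (d(Suc k := d'))"
    unfolding hyperbolic_system_def
  proof (intro conjI ballI, goal_cases)
    case (1 i) then show ?case using e' system_in_lattice by (auto simp: le_Suc_eq)
  next
    case (2 i) then show ?case using f'' system_in_lattice by (auto simp: le_Suc_eq)
  next
    case (3 i) then show ?case using d' system_divisor by (auto simp: le_Suc_eq)
  next
    case (4 i x) then show ?case using e'_values sys unfolding hyperbolic_system_def by (auto simp: le_Suc_eq)
  next
    case (5 i x) then show ?case using f''_values sys unfolding hyperbolic_system_def by (auto simp: le_Suc_eq)
  next
    case (6 i j) then show ?case
      using system_form(1) ee' form_eq_0_commute[of e'] by (auto simp: le_Suc_eq alternating)
  next
    case (7 i j) then show ?case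
      using system_form(2) ef'' form_eq_0_commute[of f''] by (auto simp: le_Suc_eq alternating)
  next
    case (8 i j) then show ?case
      using system_form(3) e'f'' ef'' ee' form_eq_0_commute[of e'] by (auto simp: le_Suc_eq)
  qed
  moreover have "(e(Suc k := e')) ` {1..Suc k} \<subseteq> Z"
    using eZ e'Z by (auto simp: le_Suc_eq)
  ultimately show ?thesis by blast
qed

lemma hyperbolic_system_splits:
  assumes Z: "R.subspace Z" "Z \<subseteq> \<Lambda>" "totally_isotropic form Z"
    and eZ: "e ` {1..k} \<subseteq> Z" and rank: "R_rank scale Z = k"
  shows "\<exists>M \<Lambda>'. adapted_splitting \<iota> scale form N \<Lambda> Z k e f d M \<Lambda>'"
proof -
  define M where "M = {pair_comb k e f a b | a b. True}"
  define \<Lambda>' where "\<Lambda>' = {x \<in> \<Lambda>. \<forall>j\<in>{1..k}. form (e j) x = 0 \<and> form (f j) x = 0}"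
  have pair0: "a i = 0 \<and> b i = 0"
    if "\<And>j. j \<in> {1..k} \<Longrightarrow> form (e j) (pair_comb k e f a b) = 0"
      "\<And>j. j \<in> {1..k} \<Longrightarrow> form (f j) (pair_comb k e f a b) = 0" and i: "i \<in> {1..k}" for a b i
    using that(1,2)[OF i] system_form_pair_comb[OF _ _ _ _ _ _ i, of a b] system_divisor(2)[OF i]
      form_eq_0_commute[of "f i"] by simp
  have Rind: "R_independent \<iota> scale (e ` {1..k})"
  proof
    assume "R.dependent (e ` {1..k})"
    then obtain u where "\<exists>v\<in>e ` {1..k}. u v \<noteq> 0" "(\<Sum>v\<in>e ` {1..k}. scale (\<iota> (u v)) v) = 0"
      using R.dependent_finite[of "e ` {1..k}"] by auto
    then have "dependent (e ` {1..k})"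
      using dependent_finite[of "e ` {1..k}"] by (auto intro!: exI[of _ "\<lambda>v. \<iota> (u v)"])
    then show False using system_independent by blast
  qed
  have "span Z \<subseteq> span (e ` {1..k})"
  proof (rule card_ge_dim_independent)
    show "e ` {1..k} \<subseteq> span Z" using eZ span_superset by blast
    show "dim (span Z) \<le> card (e ` {1..k})"
      unfolding card_image[OF system_inj_on] using rank by (simp add: R_rank_def)
  qed (rule system_independent)
  then have spanZ: "Z \<subseteq> span (e ` {1..k})" using span_superset by blast
  have "z \<in> R.span (e ` {1..k})" if z: "z \<in> Z" for z
  proof -
    obtain h where h: "h \<in> R.span (e ` {1..k})" "z - h \<in> Z"
      "\<And>j. j \<in> {1..k} \<Longrightarrow> form (f j) (z - h) = 0"
      using isotropic_projection[OF Z eZ z] by blast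
    then have "z - h \<in> span (e ` {1..k})" using spanZ by blast
    then obtain u where "z - h = (\<Sum>v\<in>e ` {1..k}. scale (u v) v)"
      by (auto simp: span_finite)
    then have u: "z - h = (\<Sum>i\<in>{1..k}. scale (u (e i)) (e i))"
      unfolding sum.reindex[OF system_inj_on] by (simp add: comp_def)
    have "form (z - h) (f j) = 0" if "j \<in> {1..k}" for j
      using h(3)[OF that] form_eq_0_commute by blast
    then have "u (e j) = 0" if "j \<in> {1..k}" for j
      using system_coefficients_eq_0[of "\<lambda>i. u (e i)"] that unfolding u by blast
    then have "z - h = 0" unfolding u by simp
    then show ?thesis using h(1) by simp
  qed
  then have Rspan: "R.span (e ` {1..k}) = Z"
    using R.span_minimal[OF eZ Z(1)] by blast
  have "form x y = 0" if x: "x \<in> R.span (f ` {1..k})" and y: "y \<in> R.span (f ` {1..k})" for x y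
  proof (rule R_span_eq_0[OF x])
    fix s
    assume s: "s \<in> f ` {1..k}"
    have "form y s = 0" by (rule R_span_eq_0[OF y]) (use s system_form(2) in blast)
    then show "form s y = 0" by (simp add: form_eq_0_commute)
  qed
  then have "adapted_system \<iota> scale form N \<Lambda> Z k e f d"
    unfolding adapted_system_def R_basis_on_def totally_isotropic_def
    using system_inj_on Rind Rspan system_in_lattice system_form system_divisor by blast
  moreover have "pair_sum \<iota> scale k e f M"
  proof (rule pair_sumI[OF M_def])
    fix a b i
    assume "pair_comb k e f a b = 0" "i \<in> {1..k}"
    then show "a i = 0 \<and> b i = 0"
      using pair0[of a b i] by simp
  qed
  moreover have "R.subspace \<Lambda>'"
    unfolding R.subspace_def \<Lambda>'_def
    by (simp add: R.subspace_0[OF lattice_submodule] R.subspace_add[OF lattice_submodule]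
        R.subspace_scale[OF lattice_submodule] form_simps)
  moreover have "orthogonal_sum form \<Lambda> M \<Lambda>'"
    unfolding orthogonal_sum_def
  proof (intro conjI ballI)
    show "\<Lambda> = {a + b | a b. a \<in> M \<and> b \<in> \<Lambda>'}"
    proof (intro set_eqI iffI)
      fix x
      assume x: "x \<in> \<Lambda>"
      obtain a b where ab: "\<And>j. j \<in> {1..k} \<Longrightarrow> form (e j) (x - pair_comb k e f a b) = 0"
        "\<And>j. j \<in> {1..k} \<Longrightarrow> form (f j) (x - pair_comb k e f a b) = 0"
        using pair_comb_projection[OF x] by blast
      have "x - pair_comb k e f a b \<in> \<Lambda>"
        by (intro R.subspace_diff lattice_submodule x pair_comb_in_lattice)
      with ab have "x - pair_comb k e f a b \<in> \<Lambda>'" unfolding \<Lambda>'_def by blast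
      moreover have "pair_comb k e f a b \<in> M" unfolding M_def by blast
      ultimately show "x \<in> {a + b | a b. a \<in> M \<and> b \<in> \<Lambda>'}"
        by (intro CollectI exI[of _ "pair_comb k e f a b"] exI[of _ "x - pair_comb k e f a b"]) simp
    next
      fix x
      assume "x \<in> {a + b | a b. a \<in> M \<and> b \<in> \<Lambda>'}"
      then obtain a b y where "x = pair_comb k e f a b + y" "y \<in> \<Lambda>"
        unfolding M_def \<Lambda>'_def by blast
      then show "x \<in> \<Lambda>"
        using R.subspace_add[OF lattice_submodule pair_comb_in_lattice] by simp
    qed
    show "M \<inter> \<Lambda>' = {0}"
    proof
      show "M \<inter> \<Lambda>' \<subseteq> {0}"
      proof
        fix x
        assume "x \<in> M \<inter> \<Lambda>'"
        then obtain a b where x: "x = pair_comb k e f a b" and "x \<in> \<Lambda>'" unfolding M_def by blast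
        then have "a i = 0 \<and> b i = 0" if "i \<in> {1..k}" for i
          using pair0[of a b i] that unfolding \<Lambda>'_def by blast
        then show "x \<in> {0}" unfolding x by (simp add: pair_comb_def)
      qed
      have "0 = pair_comb k e f (\<lambda>_. 0) (\<lambda>_. 0)" by (simp add: pair_comb_def)
      then have "0 \<in> M" unfolding M_def by blast
      then show "{0} \<subseteq> M \<inter> \<Lambda>'" using R.subspace_0[OF \<open>R.subspace \<Lambda>'\<close>] by blast
    qed
    show "form x y = 0" if "x \<in> M" "y \<in> \<Lambda>'" for x y
      using that pair_comb_orthogonal unfolding M_def \<Lambda>'_def by blast
  qed
  ultimately show ?thesis unfolding adapted_splitting_def by blast
qed

end

lemma hyperbolic_system_exists:
  assumes Z: "R.subspace Z" "Z \<subseteq> \<Lambda>" "primitive_in scale \<Lambda> Z" "totally_isotropic form Z"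
    and "k \<le> R_rank scale Z"
  shows "\<exists>e f d. hyperbolic_system k e f d \<and> e ` {1..k} \<subseteq> Z"
  using \<open>k \<le> R_rank scale Z\<close>
proof (induction k)
  case 0
  then show ?case by (auto simp: hyperbolic_system_def)
next
  case (Suc k)
  then obtain e f d where "hyperbolic_system k e f d" "e ` {1..k} \<subseteq> Z" by auto
  then show ?case using hyperbolic_system_extend[OF _ Z] Suc.prems by simp
qed

lemma adapted_splitting_exists:
  assumes "R.subspace Z" "Z \<subseteq> \<Lambda>" "primitive_in scale \<Lambda> Z" "totally_isotropic form Z"
    and "R_rank scale Z = r"
  shows "\<exists>e f d M \<Lambda>'. adapted_splitting \<iota> scale form N \<Lambda> Z r e f d M \<Lambda>'"
proof -
  obtain e f d where sys: "hyperbolic_system r e f d" and eZ: "e ` {1..r} \<subseteq> Z"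
    using hyperbolic_system_exists[OF assms(1-4), of r] assms(5) by blast
  show ?thesis
    using hyperbolic_system_splits[OF sys assms(1,2,4) eZ assms(5)] by blast
qed

lemma maximal_adapted_splitting:
  assumes spl: "adapted_splitting \<iota> scale form N \<Lambda> Z r e f d M \<Lambda>'"
    and max: "maximal_totally_isotropic \<iota> scale form \<Lambda> Z"
  shows "M = \<Lambda>" and "m \<le> r"
proof -
  have sys: "adapted_system \<iota> scale form N \<Lambda> Z r e f d" and sum: "pair_sum \<iota> scale r e f M"
    and \<Lambda>': "R.subspace \<Lambda>'" and orth: "orthogonal_sum form \<Lambda> M \<Lambda>'"
    using spl unfolding adapted_splitting_def by blast+
  note M = pair_sumD[OF sum]
  have Zspan: "Z = R.span (e ` {1..r})"
    using sys unfolding adapted_system_def R_basis_on_def by blast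
  have disj: "M \<inter> \<Lambda>' = {0}" and M\<Lambda>': "\<And>x y. x \<in> M \<Longrightarrow> y \<in> \<Lambda>' \<Longrightarrow> form x y = 0"
    and \<Lambda>: "\<Lambda> = {a + b | a b. a \<in> M \<and> b \<in> \<Lambda>'}"
    using orth unfolding orthogonal_sum_def by blast+
  have ZM: "Z \<subseteq> M"
    unfolding Zspan by (rule R_span_subset_pair_sum[OF M])
  have "v = 0" if v: "v \<in> \<Lambda>'" for v
  proof -
    have "0 \<in> M" using disj by blast
    then have v\<Lambda>: "v \<in> \<Lambda>" unfolding \<Lambda> using v by force
    let ?Y = "R.span (insert v Z)"
    have vZ: "form s t = 0" if "s \<in> insert v Z" "t \<in> insert v Z" for s t
      using that max ZM M\<Lambda>' v alternating form_eq_0_commute[of v]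
      unfolding maximal_totally_isotropic_def totally_isotropic_def by auto
    have "form x y = 0" if x: "x \<in> ?Y" and y: "y \<in> ?Y" for x y
    proof (rule R_span_eq_0[OF x])
      fix s
      assume s: "s \<in> insert v Z"
      have "form y s = 0" by (rule R_span_eq_0[OF y]) (use s vZ in blast)
      then show "form s y = 0" by (simp add: form_eq_0_commute)
    qed
    then have "totally_isotropic form ?Y" unfolding totally_isotropic_def by blast
    moreover have "?Y \<subseteq> \<Lambda>"
      using v\<Lambda> max unfolding maximal_totally_isotropic_def
      by (intro R.span_minimal lattice_submodule) blast
    moreover have "R.subspace ?Y" "Z \<subseteq> ?Y" using R.span_superset[of "insert v Z"] by auto
    ultimately have "?Y = Z" using max unfolding maximal_totally_isotropic_def by blast
    then have "v \<in> Z" using R.span_superset[of "insert v Z"] by blast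
    then show ?thesis using ZM disj v by blast
  qed
  then have "\<Lambda>' = {0}" using R.subspace_0[OF \<Lambda>'] by blast
  then show "M = \<Lambda>" unfolding \<Lambda> by simp
  have "pair_comb r e f a b \<in> span (e ` {1..r} \<union> f ` {1..r})" for a b
    unfolding pair_comb_def by (intro span_add span_sum span_scale span_base) auto
  then have "\<Lambda> \<subseteq> span (e ` {1..r} \<union> f ` {1..r})" using \<open>M = \<Lambda>\<close> M by blast
  then have "UNIV \<subseteq> span (e ` {1..r} \<union> f ` {1..r})"
    using span_minimal[OF _ subspace_span, of \<Lambda>] span_lattice by blast
  then have "dim UNIV \<le> card (e ` {1..r} \<union> f ` {1..r})" by (rule dim_le_card) simp
  also have "\<dots> \<le> card (e ` {1..r}) + card (f ` {1..r})" by (rule card_Un_le)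
  also have "\<dots> \<le> r + r" using card_image_le[of "{1..r}" e] card_image_le[of "{1..r}" f] by simp
  finally show "m \<le> r" unfolding dim_space by simp
qed

end

theorem theorem2p5:
  fixes \<iota> :: "'r::principal_ideal_domain \<Rightarrow> 'f::field"
    and scale :: "'f \<Rightarrow> 'v::ab_group_add \<Rightarrow> 'v"
    and form :: "'v \<Rightarrow> 'v \<Rightarrow> 'f"
    and N :: 'r and m r :: nat and \<Lambda> Z :: "'v set"
  assumes "fraction_field \<iota>"
    and "alternating_space scale form"
    and "\<exists>Basis. finite_dimensional_vector_space scale Basis"
    and "vector_space.dim scale UNIV = 2 * m"
    and "squarefree N"
    and "R_lattice \<iota> scale m \<Lambda>"
    and "integral_on \<iota> form \<Lambda>"
    and "level_dvd \<iota> scale form \<Lambda> N"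
    and "R_submodule \<iota> scale Z" and "Z \<subseteq> \<Lambda>"
    and "primitive_in scale \<Lambda> Z"
    and "totally_isotropic form Z"
    and "R_rank scale Z = r" and "r \<le> m"
  shows
    "(\<exists>e f d M \<Lambda>'. adapted_splitting \<iota> scale form N \<Lambda> Z r e f d M \<Lambda>') \<and>
     (\<forall>e f d M \<Lambda>' X.
        adapted_splitting \<iota> scale form N \<Lambda> Z r e f d M \<Lambda>' \<and>
        R_submodule \<iota> scale X \<and> X \<subseteq> \<Lambda> \<and> Z \<subseteq> X \<and> Z \<subseteq> radical form X \<longrightarrow>
        orthogonal_sum form X Z (X \<inter> \<Lambda>') \<and>
        (nondegenerate_on form (X \<inter> \<Lambda>') \<longleftrightarrow> Z = radical form X)) \<and>
     (maximal_totally_isotropic \<iota> scale form \<Lambda> Z \<longrightarrow>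
        (\<exists>e f d. adapted_system \<iota> scale form N \<Lambda> Z m e f d \<and> pair_sum \<iota> scale m e f \<Lambda>))"
proof -
  interpret fraction_field \<iota> by fact
  interpret alternating_space scale form by fact
  obtain Basis where "finite_dimensional_vector_space scale Basis"
    using assms(3) by blast
  then interpret finite_dimensional_vector_space scale Basis .
  interpret alternating_lattice \<iota> scale form Basis N m \<Lambda>
    by unfold_locales (fact assms)+
  obtain e f d M \<Lambda>' where spl: "adapted_splitting \<iota> scale form N \<Lambda> Z r e f d M \<Lambda>'"
    using adapted_splitting_exists[OF assms(9-13)] by blast
  have "adapted_system \<iota> scale form N \<Lambda> Z m e f d \<and> pair_sum \<iota> scale m e f \<Lambda>"
    if "maximal_totally_isotropic \<iota> scale form \<Lambda> Z"
    using maximal_adapted_splitting[OF spl that] spl \<open>r \<le> m\<close>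
    unfolding adapted_splitting_def by auto
  moreover have "\<forall>e f d M \<Lambda>' X.
        adapted_splitting \<iota> scale form N \<Lambda> Z r e f d M \<Lambda>' \<and>
        R_submodule \<iota> scale X \<and> X \<subseteq> \<Lambda> \<and> Z \<subseteq> X \<and> Z \<subseteq> radical form X \<longrightarrow>
        orthogonal_sum form X Z (X \<inter> \<Lambda>') \<and>
        (nondegenerate_on form (X \<inter> \<Lambda>') \<longleftrightarrow> Z = radical form X)"
    by (intro allI impI conjI; elim conjE;
        rule adapted_splitting_radical[OF _ N_nonzero \<open>totally_isotropic form Z\<close>]; assumption)
  ultimately show ?thesis using spl by blast
qed

end
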